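(* Let $G$ be a countably infinite discrete group and let $X$ be an aperiodic Polish $G$-space. Then there is a $G$-invariant comeager Borel set $D\subseteq X$ such that the Borel $G$-space $D$ admits a $4$-generator.
   Context: A Polish $G$-space is a Polish space equipped with a continuous action of $G$; it is aperiodic if every $G$-orbit is infinite. A Borel $G$-space is a standard Borel space equipped with a Borel action of $G$. A $k$-generator for a Borel $G$-space $D$ is a partition $\{A_n\}_{n<k}$ of $D$ into Borel sets (pieces may be empty) such that $\{gA_n : g\in G, n<k\}$ generates the Borel $\sigma$-algebra of $D$. *)

theory Defs
  imports "HOL-Analysis.Analysis" "HOL-Algebra.Group_Action"
begin

definition Polish_space :: "'x topology \<Rightarrow> bool" where
  "Polish_space X \<longleftrightarrow> separable_space X \<and> completely_metrizable_space X"

text \<open>The group carries the discrete topology, so continuity of the action is continuity on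
  the product of that topology with \<open>X\<close>.\<close>

definition Polish_G_space :: "('g, 'm) monoid_scheme \<Rightarrow> 'x topology \<Rightarrow> ('g \<Rightarrow> 'x \<Rightarrow> 'x) \<Rightarrow> bool" where
  "Polish_G_space G X \<phi> \<longleftrightarrow>
     Polish_space X \<and>
     group_action G (topspace X) \<phi> \<and>
     continuous_map (prod_topology (discrete_topology (carrier G)) X) X (\<lambda>(g, x). \<phi> g x)"

definition aperiodic_action :: "('g, 'm) monoid_scheme \<Rightarrow> 'x set \<Rightarrow> ('g \<Rightarrow> 'x \<Rightarrow> 'x) \<Rightarrow> bool" where
  "aperiodic_action G E \<phi> \<longleftrightarrow> (\<forall>x\<in>E. infinite (orbit G \<phi> x))"

definition invariant_set :: "('g, 'm) monoid_scheme \<Rightarrow> ('g \<Rightarrow> 'x \<Rightarrow> 'x) \<Rightarrow> 'x set \<Rightarrow> bool" where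
  "invariant_set G \<phi> D \<longleftrightarrow> (\<forall>g\<in>carrier G. \<phi> g ` D = D)"

definition nowhere_dense_in :: "'x topology \<Rightarrow> 'x set \<Rightarrow> bool" where
  "nowhere_dense_in X S \<longleftrightarrow> S \<subseteq> topspace X \<and> X interior_of (X closure_of S) = {}"

definition meager_in :: "'x topology \<Rightarrow> 'x set \<Rightarrow> bool" where
  "meager_in X S \<longleftrightarrow> (\<exists>\<N>. countable \<N> \<and> (\<forall>N\<in>\<N>. nowhere_dense_in X N) \<and> S = \<Union>\<N>)"

definition comeager_in :: "'x topology \<Rightarrow> 'x set \<Rightarrow> bool" where
  "comeager_in X S \<longleftrightarrow> S \<subseteq> topspace X \<and> meager_in X (topspace X - S)"

definition borel_of :: "'x topology \<Rightarrow> 'x measure" where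
  "borel_of X = sigma (topspace X) {U. openin X U}"

text \<open>\<open>M\<close> is used only as a measurable space. Only the values of \<open>\<phi>\<close> on \<open>space M\<close> matter, so for an
  invariant subset \<open>D\<close> the restricted action on \<open>D\<close> can be given by \<open>\<phi>\<close> itself.\<close>

definition is_generator ::
  "('g, 'm) monoid_scheme \<Rightarrow> 'x measure \<Rightarrow> ('g \<Rightarrow> 'x \<Rightarrow> 'x) \<Rightarrow> nat \<Rightarrow> (nat \<Rightarrow> 'x set) \<Rightarrow> bool" where
  "is_generator G M \<phi> k A \<longleftrightarrow>
     (\<forall>n<k. A n \<in> sets M) \<and>
     disjoint_family_on A {..<k} \<and>
     (\<Union>n<k. A n) = space M \<and>
     sigma_sets (space M) {\<phi> g ` A n | g n. g \<in> carrier G \<and> n < k} = sets M"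

end

theory Submission
  imports Defs
begin

text \<open>Let \<open>U n\<close> enumerate a base. A family of disjoint Borel sets, \<open>escape v\<close>, is obtained by comparing
  the itinerary of a point with an accumulation point of the itineraries of its orbit; every orbit with
  infinitely many itineraries meets \<open>escape v\<close> for arbitrarily large \<open>v\<close>. Membership in a set can
  therefore be prescribed generically and independently on the sets \<open>escape v\<close>.

  Using itineraries with respect to the base, a generic set \<open>C\<close> that equals some \<open>U (\<alpha> v)\<close> on each
  \<open>escape v\<close> has translates separating any two points of a generic orbit. Itineraries with respect to the
  translates of \<open>C\<close> then give new escape sets, which lie in the \<open>\<sigma>\<close>-algebra generated by these translates.
  A second generic set \<open>B\<close> stores the bits \<open>x \<in> U n\<close> on the new escape sets at places that can be
  recovered from \<open>C\<close>. The four atoms of the algebra generated by \<open>B\<close> and \<open>C\<close> form the generator.\<close>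

section \<open>Baire category in Polish spaces\<close>

lemma second_countable_if_Polish:
  assumes "Polish_space X"
  shows "second_countable X"
proof -
  obtain C where C: "countable C" "C \<subseteq> topspace X" "X closure_of C = topspace X"
    using assms by (auto simp: Polish_space_def separable_space_def)
  obtain M d where "Metric_space M d" and X: "X = Metric_space.mtopology M d"
    using assms by (auto simp: Polish_space_def completely_metrizable_space_def)
  interpret Metric_space M d by fact
  define \<B> where "\<B> = (\<lambda>(c, n). mball c (1 / Suc n)) ` (C \<times> (UNIV :: nat set))"
  show ?thesis
    unfolding second_countable_def
  proof (intro exI conjI ballI allI impI)
    show "countable \<B>"
      unfolding \<B>_def using C(1) by (intro countable_image countable_SIGMA) auto
    show "openin X V" if "V \<in> \<B>" for V
      using that by (auto simp: \<B>_def X)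
    fix U x assume "openin X U \<and> x \<in> U"
    then have x: "x \<in> M" "x \<in> U" and "\<exists>r>0. mball x r \<subseteq> U"
      by (auto simp: X openin_mtopology)
    then obtain r where r: "r > 0" "mball x r \<subseteq> U" by blast
    obtain n :: nat where n: "1 / Suc n < r / 2"
      using r(1) nat_approx_posE[of "r/2"] by auto
    have "x \<in> X closure_of C" using C(3) x by (simp add: X)
    then obtain c where c: "c \<in> C" "c \<in> mball x (1 / Suc n)"
      unfolding X metric_closure_of by (auto dest!: spec[of _ "1 / Suc n"])
    have "mball c (1 / Suc n) \<subseteq> mball x r"
    proof
      fix y assume y: "y \<in> mball c (1 / Suc n)"
      then have "d x y \<le> d x c + d c y" using c x triangle by auto
      then show "y \<in> mball x r" using c y n by auto
    qed
    then show "\<exists>V\<in>\<B>. x \<in> V \<and> V \<subseteq> U"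
      using c r(2) by (intro bexI[of _ "mball c (1 / Suc n)"]) (auto simp: \<B>_def commute)
  qed
qed

text \<open>The empty set and the whole space are included so that a generic parameter can switch an
  escape set off or on entirely.\<close>

definition enumerates_base :: "'x topology \<Rightarrow> (nat \<Rightarrow> 'x set) \<Rightarrow> bool" where
  "enumerates_base X U \<longleftrightarrow> (\<forall>n. openin X (U n)) \<and> {} \<in> range U \<and> topspace X \<in> range U \<and>
     (\<forall>V x. openin X V \<longrightarrow> x \<in> V \<longrightarrow> (\<exists>n. x \<in> U n \<and> U n \<subseteq> V))"

lemma Polish_space_enumerates_base:
  assumes "Polish_space X"
  obtains U where "enumerates_base X U"
proof -
  obtain \<B> where \<B>: "countable \<B>" "\<forall>V\<in>\<B>. openin X V"
      "\<forall>U x. openin X U \<and> x \<in> U \<longrightarrow> (\<exists>V \<in> \<B>. x \<in> V \<and> V \<subseteq> U)"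
    using second_countable_if_Polish[OF assms] unfolding second_countable_def by blast
  define \<B>' where "\<B>' = insert {} (insert (topspace X) \<B>)"
  have r: "range (from_nat_into \<B>') = \<B>'"
    unfolding \<B>'_def using \<B>(1) by (intro range_from_nat_into) auto
  have "enumerates_base X (from_nat_into \<B>')"
    unfolding enumerates_base_def r
  proof (intro conjI allI impI)
    show "openin X (from_nat_into \<B>' n)" for n
    proof -
      have "from_nat_into \<B>' n \<in> \<B>'" using r by blast
      then show ?thesis using \<B>(2) unfolding \<B>'_def by auto
    qed
    show "\<exists>n. x \<in> from_nat_into \<B>' n \<and> from_nat_into \<B>' n \<subseteq> V" if V: "openin X V" "x \<in> V" for V x
    proof -
      obtain W where W: "W \<in> \<B>'" "x \<in> W" "W \<subseteq> V"
        using \<B>(3) V unfolding \<B>'_def by (meson insertCI)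
      have "W \<in> range (from_nat_into \<B>')" using W(1) by (simp only: r)
      with W show ?thesis by auto
    qed
  qed (auto simp: \<B>'_def)
  then show ?thesis by (rule that)
qed

section \<open>Meager sets\<close>

lemma nowhere_dense_in_subset:
  assumes "nowhere_dense_in X S" "T \<subseteq> S"
  shows "nowhere_dense_in X T"
  using assms closure_of_mono[of T S X] interior_of_mono[of "X closure_of T" "X closure_of S" X]
  by (auto simp: nowhere_dense_in_def)

lemma meager_in_subset:
  assumes "meager_in X S" "T \<subseteq> S"
  shows "meager_in X T"
proof -
  obtain \<N> where \<N>: "countable \<N>" "\<forall>N\<in>\<N>. nowhere_dense_in X N" "S = \<Union>\<N>"
    using assms(1) by (auto simp: meager_in_def)
  have "T = \<Union>((\<inter>) T ` \<N>)" using assms(2) \<N>(3) by auto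
  moreover have "\<forall>N\<in>(\<inter>) T ` \<N>. nowhere_dense_in X N"
    using \<N>(2) by (auto intro: nowhere_dense_in_subset)
  ultimately show ?thesis
    unfolding meager_in_def using \<N>(1) by (intro exI[of _ "(\<inter>) T ` \<N>"]) auto
qed

lemma meager_in_UN:
  assumes "countable I" "\<And>i. i \<in> I \<Longrightarrow> meager_in X (S i)"
  shows "meager_in X (\<Union>i\<in>I. S i)"
proof -
  have "\<forall>i\<in>I. \<exists>\<N>. countable \<N> \<and> (\<forall>N\<in>\<N>. nowhere_dense_in X N) \<and> S i = \<Union>\<N>"
    using assms(2) by (auto simp: meager_in_def)
  then obtain \<N> where \<N>: "\<And>i. i \<in> I \<Longrightarrow> countable (\<N> i) \<and> (\<forall>N\<in>\<N> i. nowhere_dense_in X N) \<and> S i = \<Union>(\<N> i)"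
    by metis
  show ?thesis
    unfolding meager_in_def using \<N> assms(1) by (intro exI[of _ "\<Union>i\<in>I. \<N> i"]) auto
qed

lemma meager_in_Un:
  assumes "meager_in X S" "meager_in X T"
  shows "meager_in X (S \<union> T)"
proof -
  have "meager_in X (\<Union>b\<in>UNIV. if b then S else T)"
    using assms by (intro meager_in_UN) auto
  then show ?thesis by (rule meager_in_subset) (auto split: if_splits)
qed

lemma meager_in_empty: "meager_in X {}"
  unfolding meager_in_def by (intro exI[of _ "{}"]) auto

lemma not_meager_in_openin:
  assumes "Polish_space X" "openin X U" "U \<noteq> {}"
  shows "\<not> meager_in X U"
proof
  assume "meager_in X U"
  then obtain \<N> where \<N>: "countable \<N>" "\<forall>N\<in>\<N>. nowhere_dense_in X N" "U = \<Union>\<N>"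
    by (auto simp: meager_in_def)
  have "X interior_of \<Union>((closure_of) X ` \<N>) = {}"
    using assms(1) \<N> by (intro Baire_category_alt) (auto simp: Polish_space_def nowhere_dense_in_def)
  moreover have "U \<subseteq> \<Union>((closure_of) X ` \<N>)"
    using \<N> closure_of_subset by (fastforce simp: nowhere_dense_in_def)
  ultimately show False
    using assms interior_of_maximal by (metis subset_empty)
qed

section \<open>Borel sets and the Baire property\<close>

lemma sets_borel_of: "sets (borel_of X) = sigma_sets (topspace X) {U. openin X U}"
  unfolding borel_of_def using openin_subset by (intro sets_measure_of) auto

lemma space_borel_of: "space (borel_of X) = topspace X"
  unfolding borel_of_def using openin_subset by (intro space_measure_of) auto

lemma sets_borel_of_openin: "openin X U \<Longrightarrow> U \<in> sets (borel_of X)"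
  by (auto simp: sets_borel_of)

text \<open>Sets that are open up to a meager set form a \<open>\<sigma>\<close>-algebra. For
  complements, the open set \<open>U\<close> is replaced by its exterior; the only new error is the
  boundary of \<open>U\<close>, which is nowhere dense.\<close>

lemma Baire_property_borel:
  assumes "S \<in> sets (borel_of X)"
  obtains U where "openin X U" "meager_in X ((S - U) \<union> (U - S))"
proof -
  have "\<exists>U. openin X U \<and> meager_in X ((S - U) \<union> (U - S))"
    using assms unfolding sets_borel_of
  proof (induction rule: sigma_sets.induct)
    case (Basic a)
    then show ?case by (intro exI[of _ a]) (auto intro: meager_in_empty)
  next
    case Empty
    then show ?case by (intro exI[of _ "{}"]) (auto intro: meager_in_empty)
  next
    case (Compl a)
    then obtain U where U: "openin X U" "meager_in X ((a - U) \<union> (U - a))" by auto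
    let ?V = "topspace X - X closure_of U"
    have "X closure_of U - U = X frontier_of U" using U by (simp add: frontier_of_openin)
    moreover have "X interior_of (X frontier_of U) = {}"
    proof -
      have "X interior_of (X frontier_of U) \<inter> U = {}"
        using U interior_of_subset[of X "X frontier_of U"] by (auto simp: frontier_of_openin)
      then have "X interior_of (X frontier_of U) \<inter> X closure_of U = {}"
        by (subst openin_Int_closure_of_eq_empty) auto
      moreover have "X interior_of (X frontier_of U) \<subseteq> X closure_of U"
        using interior_of_subset[of X "X frontier_of U"] by (auto simp: frontier_of_def)
      ultimately show ?thesis by blast
    qed
    ultimately have "nowhere_dense_in X (X closure_of U - U)"
      using closedin_frontier_of[of X U] frontier_of_subset_topspace[of X U]
      by (simp add: nowhere_dense_in_def closure_of_closedin)
    then have "meager_in X (X closure_of U - U)"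
      unfolding meager_in_def by (intro exI[of _ "{X closure_of U - U}"]) auto
    then have "meager_in X (((a - U) \<union> (U - a)) \<union> (X closure_of U - U))"
      using U(2) by (rule meager_in_Un[rotated])
    then have "meager_in X ((topspace X - a - ?V) \<union> (?V - (topspace X - a)))"
      by (rule meager_in_subset) (use closure_of_subset[OF openin_subset[OF U(1)]] in auto)
    then show ?case by (intro exI[of _ ?V]) auto
  next
    case (Union a)
    then obtain U where U: "\<And>i::nat. openin X (U i)" "\<And>i. meager_in X ((a i - U i) \<union> (U i - a i))"
      by metis
    have "meager_in X (\<Union>i\<in>UNIV. (a i - U i) \<union> (U i - a i))"
      by (rule meager_in_UN) (use U in auto)
    then have "meager_in X ((\<Union>(range a) - \<Union>(range U)) \<union> (\<Union>(range U) - \<Union>(range a)))"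
      by (rule meager_in_subset) auto
    then show ?case using U(1) by (intro exI[of _ "\<Union>(range U)"]) auto
  qed
  then show ?thesis using that by blast
qed

text \<open>The complement of \<open>S\<close> agrees with an open \<open>V\<close> up to a meager
  set. If \<open>V\<close> were nonempty, \<open>S\<close> would be meager in some nonempty basic
  set inside \<open>V\<close>.\<close>

lemma comeager_in_if_nowhere_meager:
  assumes U: "enumerates_base X U"
    and S: "S \<in> sets (borel_of X)"
    and nonmeager: "\<And>m. U m \<noteq> {} \<Longrightarrow> \<not> meager_in X (S \<inter> U m)"
  shows "comeager_in X S"
proof -
  have "topspace X - S \<in> sets (borel_of X)"
    using sets.compl_sets[OF S] by (simp add: space_borel_of)
  then obtain V where V: "openin X V" and
    m: "meager_in X ((topspace X - S - V) \<union> (V - (topspace X - S)))"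
    by (rule Baire_property_borel)
  have "V = {}"
  proof (rule ccontr)
    assume "V \<noteq> {}"
    then obtain x where "x \<in> V" by blast
    with V U obtain n where "x \<in> U n" "U n \<subseteq> V"
      unfolding enumerates_base_def by meson
    then have n: "U n \<noteq> {}" "U n \<subseteq> V" by auto
    have "meager_in X (S \<inter> U n)"
      by (rule meager_in_subset[OF m]) (use n in auto)
    then show False using nonmeager n by blast
  qed
  then show ?thesis
    using m sets.sets_into_space[OF S] by (simp add: comeager_in_def space_borel_of)
qed

lemma comeager_in_INT:
  assumes "countable I" "I \<noteq> {}" "\<And>i. i \<in> I \<Longrightarrow> comeager_in X (S i)"
  shows "comeager_in X (\<Inter>i\<in>I. S i)"
proof -
  have "meager_in X (\<Union>i\<in>I. topspace X - S i)"
    using assms by (intro meager_in_UN) (auto simp: comeager_in_def)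
  then have "meager_in X (topspace X - (\<Inter>i\<in>I. S i))"
    by (rule meager_in_subset) auto
  then show ?thesis using assms unfolding comeager_in_def by blast
qed

text \<open>Baire category in sequence space: the hypothesis says that each \<open>P r\<close>
  contains a dense open set, and countably many such requirements are met by successively
  lengthening a prefix.\<close>

lemma exists_generic_sequence:
  fixes P :: "'r::countable \<Rightarrow> (nat \<Rightarrow> 'c) \<Rightarrow> bool"
  assumes "\<And>r \<alpha> l. \<exists>\<beta> L. (\<forall>i<l. \<beta> i = \<alpha> i) \<and> (\<forall>\<gamma>. (\<forall>i<L. \<gamma> i = \<beta> i) \<longrightarrow> P r \<gamma>)"
  shows "\<exists>\<alpha>. \<forall>r. P r \<alpha>"
proof -
  \<comment> \<open>A state is a sequence with the length of its frozen prefix. This length grows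
    strictly, so every coordinate is eventually frozen.\<close>
  let ?R = "\<lambda>n (\<alpha>, l::nat) (\<beta>, L). (\<forall>i<l. \<beta> i = \<alpha> i) \<and> l < L \<and>
              (\<forall>\<gamma>. (\<forall>i<L. \<gamma> i = \<beta> i) \<longrightarrow> P (from_nat n) \<gamma>)"
  have "\<exists>q. True \<and> ?R n p q" for p n
  proof (cases p)
    case (Pair \<alpha> l)
    obtain \<beta> L where "\<forall>i<l. \<beta> i = \<alpha> i" "\<forall>\<gamma>. (\<forall>i<L. \<gamma> i = \<beta> i) \<longrightarrow> P (from_nat n) \<gamma>"
      using assms by blast
    then show ?thesis using Pair by (intro exI[of _ "(\<beta>, max L (Suc l))"]) auto
  qed
  then obtain f where f: "\<And>n. ?R n (f n) (f (Suc n))"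
    using dependent_nat_choice[of "\<lambda>_ _. True" ?R] by auto
  define a where "a n = fst (f n)" for n
  define l where "l n = snd (f n)" for n
  have step: "\<And>n i. i < l n \<Longrightarrow> a (Suc n) i = a n i" "\<And>n. l n < l (Suc n)"
    "\<And>n \<gamma>. (\<forall>i<l (Suc n). \<gamma> i = a (Suc n) i) \<Longrightarrow> P (from_nat n) \<gamma>"
    using f by (auto simp: a_def l_def case_prod_beta)
  have mono: "strict_mono l" using step(2) by (simp add: strict_mono_Suc_iff)
  have agree: "a m i = a n i" if "n \<le> m" "i < l n" for m n i
    using that(1)
  proof (induction m rule: dec_induct)
    case (step k)
    have "i < l k" using mono step that(2) by (meson less_le_trans strict_mono_less_eq)
    then show ?case using \<open>\<And>n i. i < l n \<Longrightarrow> a (Suc n) i = a n i\<close> step by simp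
  qed simp
  \<comment> \<open>Coordinate \<open>i\<close> is frozen by stage \<open>Suc i\<close>, because
    \<open>i < l (Suc i)\<close>.\<close>
  define \<alpha> where "\<alpha> i = a (Suc i) i" for i
  have \<alpha>: "\<alpha> i = a n i" if "i < l n" for i n
  proof -
    have "i < l (Suc i)" using strict_mono_imp_increasing[OF mono, of "Suc i"] by simp
    then show ?thesis unfolding \<alpha>_def using that agree[of "Suc i" n i] agree[of n "Suc i" i]
      by (metis linorder_le_cases)
  qed
  have "P r \<alpha>" for r
    using step(3)[of "to_nat r" \<alpha>] \<alpha> by simp
  then show ?thesis by blast
qed

text \<open>A Kuratowski--Ulam argument in disguise: a property that, for each point of a comeager set,
  holds for generic parameters holds, for some parameter, at comeagerly many points.\<close>

lemma exists_generic_parameter: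
  fixes E :: "'r::countable \<Rightarrow> (nat \<Rightarrow> 'c::countable) \<Rightarrow> 'x set"
  assumes X: "Polish_space X" and U: "enumerates_base X U" and Z: "comeager_in X Z"
    and E: "\<And>r \<alpha>. E r \<alpha> \<in> sets (borel_of X)"
    and ext: "\<And>r x \<alpha> l. x \<in> Z \<Longrightarrow>
      \<exists>\<beta> L. (\<forall>i<l. \<beta> i = \<alpha> i) \<and> (\<forall>\<gamma>. (\<forall>i<L. \<gamma> i = \<beta> i) \<longrightarrow> x \<in> E r \<gamma>)"
  shows "\<exists>\<alpha>. \<forall>r. comeager_in X (E r \<alpha>)"
proof -
  let ?P = "\<lambda>(r, m) \<alpha>. U m \<noteq> {} \<longrightarrow> \<not> meager_in X (E r \<alpha> \<inter> U m)"
  have "\<exists>\<alpha>. \<forall>p. ?P p \<alpha>"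
  proof (rule exists_generic_sequence)
    fix p :: "'r \<times> nat" and \<alpha> :: "nat \<Rightarrow> 'c" and l :: nat
    obtain r m where p: "p = (r, m)" by force
    show "\<exists>\<beta> L. (\<forall>i<l. \<beta> i = \<alpha> i) \<and> (\<forall>\<gamma>. (\<forall>i<L. \<gamma> i = \<beta> i) \<longrightarrow> ?P p \<gamma>)"
    proof (cases "U m = {}")
      case True
      then show ?thesis by (intro exI[of _ \<alpha>]) (auto simp: p)
    next
      case False
      \<comment> \<open>There are only countably many finite prefixes, and those in
        \<open>\<S>\<close> force the event at every point of \<open>U m\<close> in
        \<open>Z\<close>. Hence one prefix \<open>s\<close> forces it on a nonmeager
        \<open>Q s\<close>, and every extension of \<open>s\<close> works.\<close>
      define \<S> where "\<S> = {s. l \<le> length s \<and> (\<forall>i<l. s ! i = \<alpha> i)}"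
      define Q where "Q s = {x\<in>U m. \<forall>\<gamma>. (\<forall>i<length s. \<gamma> i = s ! i) \<longrightarrow> x \<in> E r \<gamma>}" for s
      have "U m \<subseteq> (\<Union>s\<in>\<S>. Q s) \<union> (topspace X - Z)"
      proof
        fix x assume x: "x \<in> U m"
        show "x \<in> (\<Union>s\<in>\<S>. Q s) \<union> (topspace X - Z)"
        proof (cases "x \<in> Z")
          case True
          obtain \<beta> L where \<beta>: "\<forall>i<l. \<beta> i = \<alpha> i" "\<forall>\<gamma>. (\<forall>i<L. \<gamma> i = \<beta> i) \<longrightarrow> x \<in> E r \<gamma>"
            using ext[OF True] by blast
          let ?s = "map \<beta> [0..<max l L]"
          have "?s \<in> \<S>" unfolding \<S>_def using \<beta>(1) by simp
          moreover have "x \<in> Q ?s" unfolding Q_def using \<beta>(2) x by simp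
          ultimately show ?thesis by (rule UnI1[OF UN_I])
        next
          case False
          moreover have "x \<in> topspace X"
            using x U openin_subset[of X "U m"] by (auto simp: enumerates_base_def)
          ultimately show ?thesis by blast
        qed
      qed
      moreover have "\<not> meager_in X (U m)"
        using X U False by (intro not_meager_in_openin) (auto simp: enumerates_base_def)
      ultimately have "\<not> meager_in X ((\<Union>s\<in>\<S>. Q s) \<union> (topspace X - Z))"
        using meager_in_subset by blast
      then have "\<not> meager_in X (\<Union>s\<in>\<S>. Q s)"
        using Z meager_in_Un by (auto simp: comeager_in_def)
      then obtain s where s: "s \<in> \<S>" "\<not> meager_in X (Q s)"
        using meager_in_UN[of \<S> X Q] by auto
      let ?\<beta> = "\<lambda>i. if i < length s then s ! i else \<alpha> i"
      have "\<not> meager_in X (E r \<gamma> \<inter> U m)" if "\<forall>i<length s. \<gamma> i = ?\<beta> i" for \<gamma>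
      proof
        assume "meager_in X (E r \<gamma> \<inter> U m)"
        then have "meager_in X (Q s)"
          by (rule meager_in_subset) (use that in \<open>auto simp: Q_def\<close>)
        then show False using s by blast
      qed
      then show ?thesis
        using s(1) by (intro exI[of _ ?\<beta>] exI[of _ "length s"]) (auto simp: p \<S>_def)
    qed
  qed
  then obtain \<alpha> where "\<And>r m. U m \<noteq> {} \<Longrightarrow> \<not> meager_in X (E r \<alpha> \<inter> U m)"
    by auto
  then have "comeager_in X (E r \<alpha>)" for r
    by (intro comeager_in_if_nowhere_meager[OF U E])
  then show ?thesis by blast
qed

section \<open>Escape sets of orbits\<close>

definition orb :: "(nat \<Rightarrow> 'x \<Rightarrow> 'x) \<Rightarrow> 'x \<Rightarrow> 'x set" where
  "orb T x = range (\<lambda>i. T i x)"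

definition matches :: "('x \<Rightarrow> nat \<Rightarrow> bool) \<Rightarrow> bool list \<Rightarrow> 'x \<Rightarrow> bool" where
  "matches F s z \<longleftrightarrow> (\<forall>i<length s. F z i = s ! i)"

text \<open>Itineraries are counted instead of points, since \<open>F\<close> may give several
  points the same itinerary.\<close>

definition thick :: "(nat \<Rightarrow> 'x \<Rightarrow> 'x) \<Rightarrow> ('x \<Rightarrow> nat \<Rightarrow> bool) \<Rightarrow> bool list \<Rightarrow> 'x \<Rightarrow> bool" where
  "thick T F s x \<longleftrightarrow> infinite (F ` {z \<in> orb T x. matches F s z})"

text \<open>The stems of \<open>x\<close> converge to an itinerary every neighbourhood of which contains infinitely many
  itineraries of points of the orbit of \<open>x\<close>, preferring \<open>True\<close> over \<open>False\<close>; they depend on the orbit only.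
  A point escapes at \<open>v\<close> if its itinerary leaves the limit exactly at position \<open>v\<close>.\<close>

primrec stem :: "(nat \<Rightarrow> 'x \<Rightarrow> 'x) \<Rightarrow> ('x \<Rightarrow> nat \<Rightarrow> bool) \<Rightarrow> 'x \<Rightarrow> nat \<Rightarrow> bool list" where
  "stem T F x 0 = []"
| "stem T F x (Suc n) = stem T F x n @ [thick T F (stem T F x n @ [True]) x]"

definition escape :: "(nat \<Rightarrow> 'x \<Rightarrow> 'x) \<Rightarrow> ('x \<Rightarrow> nat \<Rightarrow> bool) \<Rightarrow> nat \<Rightarrow> 'x \<Rightarrow> bool" where
  "escape T F v z \<longleftrightarrow> matches F (stem T F z v) z \<and> \<not> matches F (stem T F z (Suc v)) z"

lemma matches_Nil [simp]: "matches F [] z"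
  by (simp add: matches_def)

lemma matches_snoc: "matches F (s @ [b]) z \<longleftrightarrow> matches F s z \<and> F z (length s) = b"
  by (auto simp: matches_def nth_append less_Suc_eq)

lemma length_stem [simp]: "length (stem T F x n) = n"
  by (induction n) auto

lemma matches_stem_mono:
  "matches F (stem T F x n) z \<Longrightarrow> m \<le> n \<Longrightarrow> matches F (stem T F x m) z"
  by (induction n) (auto simp: matches_snoc le_Suc_eq simp del: stem.simps(1))

text \<open>A later stem extends an earlier one, so a first departure happens only once. This makes
  the escape sets disjoint and lets them be prescribed independently.\<close>

lemma escape_unique:
  assumes "escape T F v z" "escape T F w z"
  shows "v = w"
proof -
  have less: "\<not> v < w" if "escape T F v z" "escape T F w z" for v w
    using that matches_stem_mono[of F T z w z "Suc v"] by (auto simp: escape_def simp del: stem.simps)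
  show ?thesis using less[OF assms] less[OF assms(2,1)] by simp
qed

lemma stem_cong_orbit:
  assumes "orb T x = orb T y"
  shows "stem T F x n = stem T F y n"
  by (induction n) (auto simp: thick_def assms)

text \<open>As in Koenig's lemma, one of the two one-bit extensions of a thick stem is thick; the
  stem takes \<open>False\<close> only when \<open>True\<close> fails.\<close>

lemma thick_stem:
  assumes "infinite (F ` orb T x)"
  shows "thick T F (stem T F x n) x"
proof (induction n)
  case 0
  then show ?case using assms by (simp add: thick_def)
next
  case (Suc n)
  let ?s = "stem T F x n"
  let ?A = "\<lambda>s. F ` {z \<in> orb T x. matches F s z}"
  have "?A ?s = ?A (?s @ [True]) \<union> ?A (?s @ [False])"
    by (auto simp: matches_snoc)
  moreover have "infinite (?A ?s)" using Suc by (simp add: thick_def)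
  ultimately have "infinite (?A (?s @ [True]) \<union> ?A (?s @ [False]))" by argo
  then have "thick T F (?s @ [True]) x \<or> thick T F (?s @ [False]) x"
    by (simp add: thick_def)
  then show ?case by (cases "thick T F (?s @ [True]) x") simp_all
qed

text \<open>The points of the orbit that match every stem have a single common itinerary, so they
  cannot exhaust the infinitely many itineraries matching a given stem.\<close>

lemma escape_unbounded:
  assumes inf: "infinite (F ` orb T x)"
    and orbit: "\<And>i. orb T (T i x) = orb T x"
  shows "\<exists>i v. l \<le> v \<and> escape T F v (T i x)"
proof -
  let ?S = "stem T F x"
  let ?A = "{z \<in> orb T x. matches F (?S l) z}"
  have "\<exists>z\<in>?A. \<exists>n. \<not> matches F (?S n) z"
  proof (rule ccontr)
    assume "\<not> ?thesis"
    then have all: "matches F (?S n) z" if "z \<in> ?A" for z n using that by blast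
    have "F z = (\<lambda>i. ?S (Suc i) ! i)" if "z \<in> ?A" for z
    proof
      fix i
      show "F z i = ?S (Suc i) ! i"
        using all[OF that, of "Suc i"] unfolding matches_def length_stem by blast
    qed
    then have "F ` ?A \<subseteq> {\<lambda>i. ?S (Suc i) ! i}" by blast
    then have "finite (F ` ?A)" by (rule finite_subset) simp
    then show False using thick_stem[OF inf, of l] by (simp add: thick_def)
  qed
  then obtain i n where z: "matches F (?S l) (T i x)" "\<not> matches F (?S n) (T i x)"
    by (auto simp: orb_def)
  \<comment> \<open>The first stem that fails lies beyond \<open>l\<close>, so it has a predecessor
    \<open>v\<close>, the last stem matched.\<close>
  define m where "m = (LEAST n. \<not> matches F (?S n) (T i x))"
  have m: "\<not> matches F (?S m) (T i x)" unfolding m_def using z(2) by (rule LeastI)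
  have least: "matches F (?S k) (T i x)" if "k < m" for k
    using not_less_Least[of k] that unfolding m_def by blast
  have "l < m"
    using m z(1) matches_stem_mono by (metis not_le)
  then obtain v where v: "m = Suc v" "l \<le> v" by (cases m) auto
  have "escape T F v (T i x)"
    using m least[of v] v stem_cong_orbit[OF orbit] by (simp add: escape_def del: stem.simps)
  then show ?thesis using v by blast
qed

text \<open>Infinitude is rewritten with quantifiers over countable types only, finite lists of
  indices standing for finite sets of itineraries; this makes \<open>thick\<close>
  measurable.\<close>

lemma infinite_image_orbit_iff:
  "infinite (F ` {z \<in> orb T x. P z}) \<longleftrightarrow>
     (\<forall>ks. \<exists>i. P (T i x) \<and> (\<forall>k\<in>set ks. \<exists>n. F (T k x) n \<noteq> F (T i x) n))"
    (is "infinite (F ` ?A) \<longleftrightarrow> ?R")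
proof
  assume inf: "infinite (F ` ?A)"
  show ?R
  proof
    fix ks
    have "\<not> F ` ?A \<subseteq> (\<lambda>k. F (T k x)) ` set ks"
      using inf finite_subset by blast
    then obtain i where i: "P (T i x)" "F (T i x) \<notin> (\<lambda>k. F (T k x)) ` set ks"
      by (auto simp: orb_def)
    have "\<exists>n. F (T k x) n \<noteq> F (T i x) n" if "k \<in> set ks" for k
      using i(2) that by (metis imageI ext)
    with i show "\<exists>i. P (T i x) \<and> (\<forall>k\<in>set ks. \<exists>n. F (T k x) n \<noteq> F (T i x) n)" by blast
  qed
next
  assume R: ?R
  show "infinite (F ` ?A)"
  proof
    assume "finite (F ` ?A)"
    moreover have "F ` ?A = (\<lambda>i. F (T i x)) ` {i. P (T i x)}" by (auto simp: orb_def)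
    ultimately obtain K where K: "finite K" "F ` ?A = (\<lambda>i. F (T i x)) ` K"
      using finite_subset_image[of "F ` ?A" "\<lambda>i. F (T i x)" "{i. P (T i x)}"] by auto
    obtain ks where ks: "set ks = K" using K(1) finite_list by blast
    obtain i where i: "P (T i x)" "\<forall>k\<in>set ks. \<exists>n. F (T k x) n \<noteq> F (T i x) n" using R by blast
    then have "F (T i x) \<in> (\<lambda>i. F (T i x)) ` K" unfolding K(2)[symmetric] by (auto simp: orb_def)
    then show False using i(2) ks by auto
  qed
qed

text \<open>Stems take values in the countable type of bit lists, so measurability can be checked
  for each fixed list and the stem substituted afterwards. An arbitrary \<open>M\<close> allows
  \<open>\<sigma>\<close>-algebras smaller than the Borel one.\<close>

lemma pred_escape:
  assumes meas: "\<And>g n. Measurable.pred M (\<lambda>x. F (T g x) n)"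
    and orbit: "\<And>x g. x \<in> space M \<Longrightarrow> orb T (T g x) = orb T x"
  shows "Measurable.pred M (\<lambda>x. escape T F v (T g x))"
proof -
  note [measurable] = meas
  have match [measurable]: "Measurable.pred M (\<lambda>x. matches F s (T g x))" for s g
    unfolding matches_def by measurable
  have thick [measurable]: "Measurable.pred M (\<lambda>x. thick T F s x)" for s
    unfolding thick_def infinite_image_orbit_iff by measurable
  have stem: "(\<lambda>x. stem T F x n) \<in> measurable M (count_space UNIV)" for n
  proof (induction n)
    case (Suc n)
    have "(\<lambda>x. s @ [thick T F (s @ [True]) x]) \<in> measurable M (count_space UNIV)" for s
      using measurable_compose[OF thick, of "\<lambda>b. s @ [b]"] by simp
    from measurable_compose_countable[OF this Suc] show ?case by simp
  qed simp
  have "Measurable.pred M (\<lambda>x. matches F (stem T F x n) (T g x))" for n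
    using measurable_compose_countable[OF match stem] .
  then have "Measurable.pred M (\<lambda>x. matches F (stem T F x v) (T g x) \<and>
      \<not> matches F (stem T F x (Suc v)) (T g x))"
    by (intro pred_intros_logic)
  then show ?thesis
    by (rule measurable_cong[THEN iffD1, rotated])
      (simp add: escape_def stem_cong_orbit[OF orbit] del: stem.simps)
qed

section \<open>Generic sets for aperiodic actions\<close>

text \<open>The acting group is represented by an enumeration \<open>T\<close> of its elements, with \<open>mul\<close> and \<open>neg\<close> computing
  indices of products and inverses, so that quantifiers over the group range over a countable type.\<close>

locale aperiodic_polish_action =
  fixes X :: "'x topology" and T :: "nat \<Rightarrow> 'x \<Rightarrow> 'x"
    and mul :: "nat \<Rightarrow> nat \<Rightarrow> nat" and neg :: "nat \<Rightarrow> nat" and U :: "nat \<Rightarrow> 'x set"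
  assumes Polish: "Polish_space X"
    and base: "enumerates_base X U"
    and continuous: "continuous_map X X (T i)"
    and T_mul: "x \<in> topspace X \<Longrightarrow> T (mul i j) x = T i (T j x)"
    and T_inv: "x \<in> topspace X \<Longrightarrow> T (neg i) (T i x) = x"
    and T_inv': "x \<in> topspace X \<Longrightarrow> T i (T (neg i) x) = x"
    and aperiodic: "x \<in> topspace X \<Longrightarrow> infinite (orb T x)"
begin

lemma T_in_space [simp]: "x \<in> topspace X \<Longrightarrow> T i x \<in> topspace X"
  using continuous_map_image_subset_topspace[OF continuous[of i]] by blast

lemma orb_T:
  assumes "x \<in> topspace X"
  shows "orb T (T i x) = orb T x"
proof -
  have "T j (T i x) \<in> orb T x" for j
    using T_mul[OF assms] by (metis orb_def rangeI)
  moreover have "T j x \<in> orb T (T i x)" for j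
  proof -
    have "T j x = T (mul j (neg i)) (T i x)"
      using assms by (simp add: T_mul T_inv)
    then show ?thesis by (simp add: orb_def)
  qed
  ultimately show ?thesis unfolding orb_def by blast
qed

lemma openin_U: "openin X (U n)"
  using base by (simp add: enumerates_base_def)

lemma base_at: "openin X V \<Longrightarrow> x \<in> V \<Longrightarrow> \<exists>n. x \<in> U n \<and> U n \<subseteq> V"
  using base by (simp add: enumerates_base_def)

lemma points_separated:
  assumes "x \<in> topspace X" "y \<in> topspace X" "x \<noteq> y"
  obtains n where "x \<in> U n" "y \<notin> U n"
proof -
  have "Hausdorff_space X"
    using Polish completely_metrizable_imp_metrizable_space metrizable_imp_Hausdorff_space
    by (auto simp: Polish_space_def)
  then have "\<exists>V W. openin X V \<and> openin X W \<and> x \<in> V \<and> y \<in> W \<and> disjnt V W"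
    using assms by (simp add: Hausdorff_space_def)
  then obtain V W where VW: "openin X V" "x \<in> V" "y \<in> W" "disjnt V W" by blast
  obtain n where "x \<in> U n" "U n \<subseteq> V" using base_at[OF VW(1,2)] by blast
  then have "x \<in> U n" "y \<notin> U n" using VW by (auto simp: disjnt_def)
  then show ?thesis by (rule that)
qed

section \<open>Borel measurability of the action and of the escape sets\<close>

lemma borel_measurable_T: "T i \<in> measurable (borel_of X) (borel_of X)"
  unfolding borel_of_def
proof (rule measurable_measure_of)
  fix V assume "V \<in> {V. openin X V}"
  then have "openin X {x \<in> topspace X. T i x \<in> V}"
    using openin_continuous_map_preimage[OF continuous] by blast
  moreover have "T i -` V \<inter> topspace X = {x \<in> topspace X. T i x \<in> V}" by auto
  ultimately show "T i -` V \<inter> space (sigma (topspace X) {U. openin X U})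
      \<in> sets (sigma (topspace X) {U. openin X U})"
    using sets_borel_of_openin space_borel_of[of X] unfolding borel_of_def by simp
qed (use openin_subset space_borel_of[of X] in \<open>auto simp: borel_of_def\<close>)

lemma pred_T_mem:
  assumes "A \<in> sets (borel_of X)"
  shows "Measurable.pred (borel_of X) (\<lambda>x. T i x \<in> A)"
  using borel_measurable_T assms by measurable

lemma pred_T_mem_U: "Measurable.pred (borel_of X) (\<lambda>x. T i x \<in> U n)"
  by (intro pred_T_mem sets_borel_of_openin openin_U)

abbreviation base_escape :: "nat \<Rightarrow> 'x \<Rightarrow> bool" where
  "base_escape \<equiv> escape T (\<lambda>x n. x \<in> U n)"

lemma pred_base_escape: "Measurable.pred (borel_of X) (\<lambda>x. base_escape v (T g x))"
  using pred_T_mem_U orb_T by (intro pred_escape) (simp_all add: space_borel_of)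

text \<open>The base separates points, so an infinite orbit has infinitely many itineraries.\<close>

lemma base_escape_unbounded:
  assumes "x \<in> topspace X"
  shows "\<exists>i v. l \<le> v \<and> base_escape v (T i x)"
proof (rule escape_unbounded)
  have "inj_on (\<lambda>x n. x \<in> U n) (orb T x)"
  proof (rule inj_onI, rule ccontr)
    fix y z assume yz: "y \<in> orb T x" "z \<in> orb T x" "(\<lambda>n. y \<in> U n) = (\<lambda>n. z \<in> U n)" "y \<noteq> z"
    then have "y \<in> topspace X" "z \<in> topspace X" using assms by (auto simp: orb_def)
    then show False using points_separated yz(3,4) by metis
  qed
  then show "infinite ((\<lambda>x n. x \<in> U n) ` orb T x)"
    using aperiodic[OF assms] finite_imageD by blast
qed (simp add: assms orb_T)

text \<open>Whatever a finite part of \<open>\<alpha>\<close> prescribes, two distinct points \<open>y\<close>, \<open>y'\<close> of an orbit can still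
  be separated: move both by \<open>T t\<close> so that \<open>y\<close> lands in an escape set of large index \<open>v\<close>, and
  choose \<open>\<alpha> v\<close> according to where \<open>y'\<close> lands.\<close>

lemma exists_orbit_separating_set:
  obtains C where "C \<in> sets (borel_of X)"
    and "comeager_in X {x \<in> topspace X. \<forall>i j. T i x \<noteq> T j x \<longrightarrow>
           (\<exists>t. (T t (T i x) \<in> C) \<noteq> (T t (T j x) \<in> C))}"
proof -
  define C where "C \<alpha> = {x \<in> topspace X. \<exists>v. base_escape v x \<and> x \<in> U (\<alpha> v)}" for \<alpha>
  \<comment> \<open>The first disjunct expresses \<open>T i x = T j x\<close> through the base, in a
    form whose measurability is evident.\<close>
  define E where "E = (\<lambda>(i, j) \<alpha>. {x \<in> topspace X. (\<forall>n. T i x \<in> U n \<longleftrightarrow> T j x \<in> U n) \<or>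
           (\<exists>t. (T t (T i x) \<in> C \<alpha>) \<noteq> (T t (T j x) \<in> C \<alpha>))})"
  \<comment> \<open>An index of the identity, obtained as a product of an element with its
    inverse.\<close>
  define e where "e = mul (neg 0) 0"
  have e: "T e x = x" if "x \<in> topspace X" for x
    using that by (simp add: e_def T_mul T_inv)
  have C_sets: "C \<alpha> \<in> sets (borel_of X)" for \<alpha>
  proof -
    have [measurable]: "Measurable.pred (borel_of X) (base_escape v)" for v
      using pred_base_escape[of v e]
      by (rule measurable_cong[THEN iffD1, rotated]) (simp add: e space_borel_of)
    have [measurable]: "Measurable.pred (borel_of X) (\<lambda>x. x \<in> U n)" for n
      using sets_borel_of_openin[OF openin_U[of n]] by measurable
    have "{x \<in> space (borel_of X). \<exists>v. base_escape v x \<and> x \<in> U (\<alpha> v)} \<in> sets (borel_of X)"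
      by measurable
    then show ?thesis by (simp add: C_def space_borel_of)
  qed
  have "\<exists>\<alpha>. \<forall>r. comeager_in X (E r \<alpha>)"
  proof (rule exists_generic_parameter[OF Polish base])
    show "comeager_in X (topspace X)"
      by (simp add: comeager_in_def meager_in_empty)
    fix r :: "nat \<times> nat" and \<alpha> :: "nat \<Rightarrow> nat"
    obtain i j where r: "r = (i, j)" by force
    note [measurable] = pred_T_mem_U pred_T_mem[OF C_sets]
    have [measurable]: "Measurable.pred (borel_of X) (\<lambda>x. T t (T i x) \<in> C \<alpha>)" for t i
      using pred_T_mem[OF C_sets, of "mul t i"]
      by (rule measurable_cong[THEN iffD1, rotated]) (simp add: T_mul space_borel_of)
    have "{x \<in> space (borel_of X). (\<forall>n. T i x \<in> U n \<longleftrightarrow> T j x \<in> U n) \<or>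
           (\<exists>t. (T t (T i x) \<in> C \<alpha>) \<noteq> (T t (T j x) \<in> C \<alpha>))} \<in> sets (borel_of X)"
      by measurable
    then show "E r \<alpha> \<in> sets (borel_of X)" by (simp add: E_def r space_borel_of)
    fix x l assume x: "x \<in> topspace X"
    show "\<exists>\<beta> L. (\<forall>i<l. \<beta> i = \<alpha> i) \<and> (\<forall>\<gamma>. (\<forall>i<L. \<gamma> i = \<beta> i) \<longrightarrow> x \<in> E r \<gamma>)"
    proof (cases "T i x = T j x")
      case True
      then show ?thesis using x by (intro exI[of _ \<alpha>]) (auto simp: E_def r)
    next
      case False
      obtain t v where t: "l \<le> v" "base_escape v (T t (T i x))"
        using base_escape_unbounded[of "T i x" l] x by auto
      let ?y = "T t (T i x)" and ?z = "T t (T j x)"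
      have sp: "?y \<in> topspace X" "?z \<in> topspace X" using x by auto
      have "?y \<noteq> ?z" using False T_inv x by (metis T_in_space)
      then obtain n where n: "?y \<in> U n" "?z \<notin> U n" using points_separated sp by blast
      obtain full empty where triv: "U full = topspace X" "U empty = {}"
        using base unfolding enumerates_base_def by (metis rangeE)
      have C_iff: "z \<in> C \<gamma> \<longleftrightarrow> z \<in> U (\<gamma> w)" if "base_escape w z" "z \<in> topspace X" for z w \<gamma>
      proof -
        have "base_escape v z \<longleftrightarrow> v = w" for v using that(1) escape_unique by metis
        then show ?thesis using that(2) by (simp add: C_def)
      qed
      \<comment> \<open>Here \<open>k\<close> is the new value at \<open>v\<close>, and
        \<open>w\<close> is the only other coordinate that can affect \<open>?z\<close>. The form
        \<open>(\<alpha>(v := k)) w\<close> also covers \<open>w = v\<close>.\<close>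
      have "\<exists>k w. \<forall>\<gamma>. \<gamma> v = k \<longrightarrow> \<gamma> w = (\<alpha>(v := k)) w \<longrightarrow> (?y \<in> C \<gamma>) \<noteq> (?z \<in> C \<gamma>)"
      proof (cases "\<exists>w. base_escape w ?z")
        case no_escape: False
        have "?z \<notin> C \<gamma>" for \<gamma> using no_escape by (simp add: C_def)
        then show ?thesis using C_iff[OF t(2) sp(1)] triv sp by (intro exI[of _ full]) simp
      next
        case True
        then obtain w where w: "base_escape w ?z" by blast
        show ?thesis
        \<comment> \<open>If both points escape at \<open>v\<close>, the same basic set decides
          both, so it must separate them. Otherwise \<open>\<alpha> w\<close> already decides
          \<open>?z\<close>, and \<open>?y\<close> is given the opposite answer.\<close>
        proof (cases "w = v")
          case True
          then show ?thesis
            using C_iff[OF t(2) sp(1)] C_iff[OF w sp(2)] n by (intro exI[of _ n] exI[of _ v]) simp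
        next
          case False
          then show ?thesis
            using C_iff[OF t(2) sp(1)] C_iff[OF w sp(2)] triv sp
            by (intro exI[of _ "if ?z \<in> U (\<alpha> w) then empty else full"] exI[of _ w]) simp
        qed
      qed
      then obtain k w where
        kw: "\<And>\<gamma>. \<gamma> v = k \<Longrightarrow> \<gamma> w = (\<alpha>(v := k)) w \<Longrightarrow> (?y \<in> C \<gamma>) \<noteq> (?z \<in> C \<gamma>)"
        by blast
      have "x \<in> E r \<gamma>" if "\<forall>i<Suc (v + w). \<gamma> i = (\<alpha>(v := k)) i" for \<gamma>
      proof -
        have "\<gamma> v = k" "\<gamma> w = (\<alpha>(v := k)) w"
          using that[rule_format, of v] that[rule_format, of w] by simp_all
        from kw[OF this] show ?thesis unfolding E_def r using x by auto
      qed
      then show ?thesis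
        using t(1) by (intro exI[of _ "\<alpha>(v := k)"] exI[of _ "Suc (v + w)"]) auto
    qed
  qed
  then obtain \<alpha> where \<alpha>: "\<And>r. comeager_in X (E r \<alpha>)" by blast
  have "comeager_in X (\<Inter>r. E r \<alpha>)"
    by (rule comeager_in_INT) (use \<alpha> in auto)
  moreover have "(\<Inter>r. E r \<alpha>) = {x \<in> topspace X. \<forall>i j. T i x \<noteq> T j x \<longrightarrow>
           (\<exists>t. (T t (T i x) \<in> C \<alpha>) \<noteq> (T t (T j x) \<in> C \<alpha>))}"
  proof -
    have eq: "(\<forall>n. T i x \<in> U n \<longleftrightarrow> T j x \<in> U n) \<longleftrightarrow> T i x = T j x" if "x \<in> topspace X" for x i j
      using points_separated[of "T i x" "T j x"] that by (metis T_in_space)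
    have E_eq: "E (i, j) \<alpha> = {x \<in> topspace X. T i x \<noteq> T j x \<longrightarrow>
           (\<exists>t. (T t (T i x) \<in> C \<alpha>) \<noteq> (T t (T j x) \<in> C \<alpha>))}" for i j
      unfolding E_def prod.case by (intro Collect_cong conj_cong refl) (simp add: eq, blast)
    have "(\<Inter>r. E r \<alpha>) = (\<Inter>i j. E (i, j) \<alpha>)" by auto
    then show ?thesis unfolding E_eq by auto
  qed
  ultimately show ?thesis using that[OF C_sets[of \<alpha>]] by simp
qed

text \<open>If \<open>\<alpha> v = (k, n)\<close>, a point \<open>z\<close> escaping at \<open>v\<close> stores in its membership in \<open>B\<close> whether \<open>T k z\<close> is in \<open>U n\<close>;
  for generic \<open>\<alpha>\<close>, every pair of a point and a basic open set is stored somewhere on the orbit, at a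
  place that can be located from \<open>C\<close> alone.\<close>

lemma exists_coding:
  obtains C B D where "C \<in> sets (borel_of X)" "B \<in> sets (borel_of X)" "D \<in> sets (borel_of X)"
    and "comeager_in X D" and "\<And>i x. x \<in> D \<Longrightarrow> T i x \<in> D"
    and "\<And>M n. space M = D \<Longrightarrow> (\<And>i. Measurable.pred M (\<lambda>x. T i x \<in> C)) \<Longrightarrow>
           (\<And>i. Measurable.pred M (\<lambda>x. T i x \<in> B)) \<Longrightarrow> U n \<inter> D \<in> sets M"
proof -
  obtain C where C: "C \<in> sets (borel_of X)"
    and Z: "comeager_in X {x \<in> topspace X. \<forall>i j. T i x \<noteq> T j x \<longrightarrow>
           (\<exists>t. (T t (T i x) \<in> C) \<noteq> (T t (T j x) \<in> C))}" (is "comeager_in X ?Z")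
    by (rule exists_orbit_separating_set)
  define F where "F x n = (T n x \<in> C)" for x n
  \<comment> \<open>Stated for any \<open>M\<close> on which the translates of \<open>C\<close> are
    measurable: it serves for the Borel sets here and for the \<open>M\<close> of the
    conclusion.\<close>
  have pred_F: "Measurable.pred M (\<lambda>x. F (T i x) n)"
    if "space M \<subseteq> topspace X" "\<And>i. Measurable.pred M (\<lambda>x. T i x \<in> C)" for M i n
    using that(2)[of "mul n i"] unfolding F_def
    by (rule measurable_cong[THEN iffD1, rotated]) (use that(1) in \<open>auto simp: T_mul\<close>)
  have pred_F_escape: "Measurable.pred M (\<lambda>x. escape T F v (T i x))"
    if "space M \<subseteq> topspace X" "\<And>i. Measurable.pred M (\<lambda>x. T i x \<in> C)" for M v i
    using pred_F[OF that] orb_T that(1) by (intro pred_escape) auto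
  define e where "e = mul (neg 0) 0"
  have e: "T e x = x" if "x \<in> topspace X" for x
    using that by (simp add: e_def T_mul T_inv)
  \<comment> \<open>With \<open>\<alpha> v = (k, n)\<close>, the point
    \<open>T (mul (neg k) g) x\<close> is where the bit for \<open>T g x\<close> and
    \<open>U n\<close> is stored, because \<open>T k\<close> carries it to
    \<open>T g x\<close>.\<close>
  define E :: "nat \<times> nat \<Rightarrow> (nat \<Rightarrow> nat \<times> nat) \<Rightarrow> 'x set" where "E = (\<lambda>(g, n) \<alpha>. {x \<in> topspace X.
      \<exists>v. snd (\<alpha> v) = n \<and> escape T F v (T (mul (neg (fst (\<alpha> v))) g) x)})"
  have "\<exists>\<alpha> :: nat \<Rightarrow> nat \<times> nat. \<forall>r. comeager_in X (E r \<alpha>)"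
  proof (rule exists_generic_parameter[OF Polish base Z])
    fix r :: "nat \<times> nat" and \<alpha> :: "nat \<Rightarrow> nat \<times> nat"
    obtain g n where r: "r = (g, n)" by force
    have [measurable]: "Measurable.pred (borel_of X) (\<lambda>x. escape T F v (T i x))" for v i
      by (intro pred_F_escape pred_T_mem C) (simp add: space_borel_of)
    have "{x \<in> space (borel_of X). \<exists>v. snd (\<alpha> v) = n \<and> escape T F v (T (mul (neg (fst (\<alpha> v))) g) x)}
        \<in> sets (borel_of X)"
      by measurable
    then show "E r \<alpha> \<in> sets (borel_of X)" unfolding E_def r prod.case space_borel_of .
    fix x l assume "x \<in> ?Z"
    then have x: "x \<in> topspace X" and
      sep: "\<And>i j. T i x \<noteq> T j x \<Longrightarrow> \<exists>t. (T t (T i x) \<in> C) \<noteq> (T t (T j x) \<in> C)" by auto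
    have "inj_on F (orb T x)"
    proof (rule inj_onI, rule ccontr)
      fix y z assume yz: "y \<in> orb T x" "z \<in> orb T x" "F y = F z" "y \<noteq> z"
      then obtain i j where "y = T i x" "z = T j x" by (auto simp: orb_def)
      with yz sep[of i j] show False by (metis F_def)
    qed
    then have "infinite (F ` orb T x)"
      using aperiodic[OF x] finite_imageD by blast
    then obtain i v where iv: "l \<le> v" "escape T F v (T i x)"
      using escape_unbounded[of F T x l] orb_T[OF x] by blast
    \<comment> \<open>Chosen so that \<open>T k\<close> moves the escaping point
      \<open>T i x\<close> to \<open>T g x\<close>.\<close>
    define k where "k = mul g (neg i)"
    have "T (mul (neg k) g) x = T i x"
    proof -
      have "T g x = T k (T i x)" using x by (simp add: k_def T_mul T_inv)
      then show ?thesis using x by (simp add: T_mul T_inv)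
    qed
    with iv have "x \<in> E r \<gamma>" if "\<gamma> v = (k, n)" for \<gamma>
      using x that unfolding E_def r by (auto intro!: exI[of _ v])
    then show "\<exists>\<beta> L. (\<forall>i<l. \<beta> i = \<alpha> i) \<and> (\<forall>\<gamma>. (\<forall>i<L. \<gamma> i = \<beta> i) \<longrightarrow> x \<in> E r \<gamma>)"
      using iv(1) by (intro exI[of _ "\<alpha>(v := (k, n))"] exI[of _ "Suc v"]) auto
  qed
  then obtain \<alpha> where \<alpha>: "\<And>r. comeager_in X (E r \<alpha>)" by blast
  define D where "D = (\<Inter>r. E r \<alpha>)"
  define B where "B = {z \<in> topspace X. \<exists>v. escape T F v z \<and> T (fst (\<alpha> v)) z \<in> U (snd (\<alpha> v))}"
  have D_alt: "D = {x \<in> topspace X.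
      \<forall>g n. \<exists>v. snd (\<alpha> v) = n \<and> escape T F v (T (mul (neg (fst (\<alpha> v))) g) x)}"
    unfolding D_def E_def by auto
  show ?thesis
  proof (rule that)
    show "C \<in> sets (borel_of X)" by (rule C)
    have esc [measurable]: "Measurable.pred (borel_of X) (\<lambda>x. escape T F v (T i x))" for v i
      by (intro pred_F_escape pred_T_mem C) (simp add: space_borel_of)
    have [measurable]: "Measurable.pred (borel_of X) (escape T F v)" for v
      using esc[of v e]
      by (rule measurable_cong[THEN iffD1, rotated]) (simp add: e space_borel_of)
    note [measurable] = pred_T_mem_U
    have "{z \<in> space (borel_of X). \<exists>v. escape T F v z \<and> T (fst (\<alpha> v)) z \<in> U (snd (\<alpha> v))}
        \<in> sets (borel_of X)" by measurable
    then show "B \<in> sets (borel_of X)" by (simp add: B_def space_borel_of)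
    have "{x \<in> space (borel_of X). \<forall>g n. \<exists>v. snd (\<alpha> v) = n \<and> escape T F v (T (mul (neg (fst (\<alpha> v))) g) x)}
        \<in> sets (borel_of X)" by measurable
    then show "D \<in> sets (borel_of X)" unfolding D_alt space_borel_of .
    show "comeager_in X D"
      unfolding D_def by (rule comeager_in_INT) (use \<alpha> in auto)
    show "T i x \<in> D" if "x \<in> D" for i x
    proof -
      have x: "x \<in> topspace X" using that unfolding D_alt by blast
      \<comment> \<open>Moving \<open>x\<close> by \<open>T i\<close> only replaces \<open>g\<close>
        by \<open>mul g i\<close>, and \<open>D\<close> asks for all \<open>g\<close>.\<close>
      have eq: "T (mul (neg k) g) (T i x) = T (mul (neg k) (mul g i)) x" for k g
        using x by (simp add: T_mul)
      show ?thesis using that T_in_space[OF x] unfolding D_alt mem_Collect_eq eq by blast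
    qed
    fix M n assume M: "space M = D" "\<And>i. Measurable.pred M (\<lambda>x. T i x \<in> C)"
      "\<And>i. Measurable.pred M (\<lambda>x. T i x \<in> B)"
    have sub: "space M \<subseteq> topspace X" using M(1) unfolding D_alt by blast
    note [measurable] = pred_F_escape[OF sub M(2)] M(3)
    \<comment> \<open>Decoding: the right-hand side depends only on translates of \<open>C\<close>,
      through \<open>F\<close>, and of \<open>B\<close>. By uniqueness of escape, \<open>B\<close>
      at a point escaping at \<open>v\<close> reads entry \<open>v\<close> alone.\<close>
    have "U n \<inter> D = {x \<in> space M. \<exists>v. snd (\<alpha> v) = n \<and>
        escape T F v (T (neg (fst (\<alpha> v))) x) \<and> T (neg (fst (\<alpha> v))) x \<in> B}"
    proof -
      have "x \<in> U n \<longleftrightarrow> (\<exists>v. snd (\<alpha> v) = n \<and>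
        escape T F v (T (neg (fst (\<alpha> v))) x) \<and> T (neg (fst (\<alpha> v))) x \<in> B)"
        if x: "x \<in> D" for x
      proof -
        have xX: "x \<in> topspace X" using x unfolding D_alt by blast
        have B_iff: "T (neg (fst (\<alpha> v))) x \<in> B \<longleftrightarrow> x \<in> U n"
          if "snd (\<alpha> v) = n" "escape T F v (T (neg (fst (\<alpha> v))) x)" for v
        proof -
          have "escape T F w (T (neg (fst (\<alpha> v))) x) \<longleftrightarrow> w = v" for w
            using that(2) escape_unique by metis
          then show ?thesis using that(1) xX by (simp add: B_def T_inv')
        qed
        \<comment> \<open>The case of the identity in \<open>D\<close> supplies a storage place for
          \<open>x\<close> itself.\<close>
        have "\<exists>v. snd (\<alpha> v) = n \<and> escape T F v (T (mul (neg (fst (\<alpha> v))) e) x)"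
          using x unfolding D_alt by blast
        then obtain v where "snd (\<alpha> v) = n" "escape T F v (T (neg (fst (\<alpha> v))) x)"
          using xX by (auto simp: T_mul e)
        then show ?thesis using B_iff by blast
      qed
      then show ?thesis unfolding M(1) by blast
    qed
    also have "\<dots> \<in> sets M" by measurable
    finally show "U n \<inter> D \<in> sets M" .
  qed
qed

end

section \<open>The generator\<close>

lemma Polish_G_space_continuous:
  assumes "Polish_G_space G X \<phi>" "g \<in> carrier G"
  shows "continuous_map X X (\<phi> g)"
proof -
  have "continuous_map X (prod_topology (discrete_topology (carrier G)) X) (\<lambda>x. (g, x))"
    using assms(2) by (simp add: continuous_map_pairedI)
  then have "continuous_map X X ((\<lambda>(g, x). \<phi> g x) \<circ> (\<lambda>x. (g, x)))"
    by (rule continuous_map_compose) (use assms(1) in \<open>simp add: Polish_G_space_def\<close>)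
  then show ?thesis by (simp add: comp_def)
qed

text \<open>Turns the translates occurring in \<open>is_generator\<close> into preimages, for which
  measurability is available.\<close>

lemma (in group_action) image_inv_Collect:
  assumes "D \<subseteq> E" "\<And>g x. g \<in> carrier G \<Longrightarrow> x \<in> D \<Longrightarrow> \<phi> g x \<in> D" "g \<in> carrier G"
  shows "\<phi> (inv g) ` {x \<in> D. P x} = {x \<in> D. P (\<phi> g x)}"
proof -
  interpret group G using group_hom group_hom.axioms(1) by auto
  have inv: "\<phi> (inv g) (\<phi> g x) = x" "\<phi> g (\<phi> (inv g) x) = x" if "x \<in> D" for x
    using orbit_sym_aux[of g x] orbit_sym_aux[of "inv g" x] assms(1,3) that by auto
  have "x \<in> \<phi> (inv g) ` {x \<in> D. P x}" if "x \<in> D" "P (\<phi> g x)" for x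
    using that inv(1)[OF that(1)] assms(2,3) by (intro image_eqI[of _ _ "\<phi> g x"]) auto
  moreover have "\<phi> (inv g) y \<in> {x \<in> D. P (\<phi> g x)}" if "y \<in> D" "P y" for y
    using that inv(2)[OF that(1)] assms(2)[of "inv g" y] assms(3) by simp
  ultimately show ?thesis by blast
qed

theorem theorem10p1:
  fixes G :: "('g, 'm) monoid_scheme"
    and X :: "'x topology"
    and \<phi> :: "'g \<Rightarrow> 'x \<Rightarrow> 'x"
  assumes "group G"
    and "countable (carrier G)"
    and "infinite (carrier G)"
    and "Polish_G_space G X \<phi>"
    and "aperiodic_action G (topspace X) \<phi>"
  shows "\<exists>D. D \<in> sets (borel_of X) \<and> comeager_in X D \<and> invariant_set G \<phi> D \<and>
           (\<exists>A. is_generator G (restrict_space (borel_of X) D) \<phi> 4 A)"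
proof -
  interpret group G by fact
  interpret group_action G "topspace X" \<phi>
    using assms(4) by (simp add: Polish_G_space_def)
  have X: "Polish_space X" using assms(4) by (simp add: Polish_G_space_def)
  then obtain U where U: "enumerates_base X U" by (rule Polish_space_enumerates_base)
  define e where "e = from_nat_into (carrier G)"
  have range_e: "range e = carrier G"
    unfolding e_def using assms(2,3) by (intro range_from_nat_into) auto
  then have e: "e i \<in> carrier G" for i by blast
  define idx where "idx = to_nat_on (carrier G)"
  have e_idx: "e (idx g) = g" if "g \<in> carrier G" for g
    using that assms(2) by (simp add: e_def idx_def)
  define T where "T i = \<phi> (e i)" for i
  have orb: "orb T x = orbit G \<phi> x" for x
    unfolding orb_def orbit_def T_def range_e[symmetric] by blast
  interpret aperiodic_polish_action X T "\<lambda>i j. idx (e i \<otimes>\<^bsub>G\<^esub> e j)" "\<lambda>i. idx (inv\<^bsub>G\<^esub> e i)" U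
  proof
    show "continuous_map X X (T i)" for i
      unfolding T_def using assms(4) e by (rule Polish_G_space_continuous)
    fix x i j assume x: "x \<in> topspace X"
    show "T (idx (e i \<otimes>\<^bsub>G\<^esub> e j)) x = T i (T j x)"
      using x e by (simp add: T_def e_idx composition_rule)
    show "T (idx (inv\<^bsub>G\<^esub> e i)) (T i x) = x"
      using x e orbit_sym_aux[of "e i" x] by (simp add: T_def e_idx)
    show "T i (T (idx (inv\<^bsub>G\<^esub> e i)) x) = x"
      using x e orbit_sym_aux[of "inv\<^bsub>G\<^esub> e i" x] by (simp add: T_def e_idx)
    show "infinite (orb T x)"
      using assms(5) x by (simp add: orb aperiodic_action_def)
  qed (use X U in auto)
  obtain C B D where C: "C \<in> sets (borel_of X)" and B: "B \<in> sets (borel_of X)"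
    and D: "D \<in> sets (borel_of X)" "comeager_in X D" and D_T: "\<And>i x. x \<in> D \<Longrightarrow> T i x \<in> D"
    and coding: "\<And>M n. space M = D \<Longrightarrow> (\<And>i. Measurable.pred M (\<lambda>x. T i x \<in> C)) \<Longrightarrow>
           (\<And>i. Measurable.pred M (\<lambda>x. T i x \<in> B)) \<Longrightarrow> U n \<inter> D \<in> sets M"
    by (rule exists_coding) blast
  have DX: "D \<subseteq> topspace X" using sets.sets_into_space[OF D(1)] by (simp add: space_borel_of)
  have D_inv: "\<phi> g x \<in> D" if "g \<in> carrier G" "x \<in> D" for g x
    using D_T[OF that(2), of "idx g"] that(1) by (simp add: T_def e_idx)
  note image_inv = image_inv_Collect[OF DX D_inv]
  have "invariant_set G \<phi> D"
    unfolding invariant_set_def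
  proof
    fix g assume "g \<in> carrier G"
    then show "\<phi> g ` D = D" using image_inv[of "inv\<^bsub>G\<^esub> g" "\<lambda>_. True"] by simp
  qed
  \<comment> \<open>The index is read in binary: the pieces 0, 1, 2, 3 are the parts of
    \<open>D\<close> in both sets, in \<open>C\<close> only, in \<open>B\<close> only and in
    neither.\<close>
  moreover have "is_generator G (restrict_space (borel_of X) D) \<phi> 4
      (\<lambda>n. {x \<in> D. (x \<in> C \<longleftrightarrow> n < 2) \<and> (x \<in> B \<longleftrightarrow> even n)})" (is "is_generator G ?M \<phi> 4 ?A")
  proof -
    have space_M: "space ?M = D" using D(1) by simp
    have sets_M: "S \<in> sets ?M \<longleftrightarrow> S \<subseteq> D \<and> S \<in> sets (borel_of X)" for S
      using D(1) sets_restrict_space_iff[of D "borel_of X" S] DX by (simp add: space_borel_of Int_absorb2)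
    have A_sets: "?A n \<in> sets ?M" for n
    proof -
      note [measurable] = C B D(1)
      have "{x \<in> space (borel_of X). x \<in> D \<and> (x \<in> C \<longleftrightarrow> n < 2) \<and> (x \<in> B \<longleftrightarrow> even n)} \<in> sets (borel_of X)"
        by measurable
      moreover have "{x \<in> space (borel_of X). x \<in> D \<and> (x \<in> C \<longleftrightarrow> n < 2) \<and> (x \<in> B \<longleftrightarrow> even n)} = ?A n"
        using DX by (auto simp: space_borel_of)
      ultimately show ?thesis by (simp add: sets_M)
    qed
    define \<G> where "\<G> = {\<phi> g ` ?A n | g n. g \<in> carrier G \<and> n < 4}"
    have gA: "\<phi> g ` ?A n \<in> sets ?M" if "g \<in> carrier G" for g n
    proof -
      let ?g = "inv\<^bsub>G\<^esub> g"
      have "\<phi> g ` ?A n = {x \<in> D. \<phi> ?g x \<in> ?A n}"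
        using image_inv[of ?g "\<lambda>x. x \<in> ?A n"] that D_inv by simp
      moreover have "T (idx ?g) = \<phi> ?g" using that by (simp add: T_def e_idx)
      moreover have "Measurable.pred (borel_of X) (\<lambda>x. T (idx ?g) x \<in> ?A n)"
        using A_sets[of n] by (intro pred_T_mem) (simp add: sets_M)
      then have "D \<inter> {x \<in> space (borel_of X). T (idx ?g) x \<in> ?A n} \<in> sets (borel_of X)"
        using D(1) by (intro sets.Int) (simp_all add: pred_def)
      moreover have "D \<inter> {x \<in> space (borel_of X). \<phi> ?g x \<in> ?A n} = {x \<in> D. \<phi> ?g x \<in> ?A n}"
        using DX by (auto simp: space_borel_of)
      ultimately show ?thesis by (simp add: sets_M)
    qed
    have \<G>_sets: "\<G> \<subseteq> sets ?M" using gA by (auto simp: \<G>_def)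
    then have \<G>_Pow: "\<G> \<subseteq> Pow D" using sets_M by blast
    \<comment> \<open>It remains to show that every Borel subset of \<open>D\<close> lies in
      \<open>N\<close>.\<close>
    define N where "N = sigma D \<G>"
    have space_N: "space N = D" and sets_N: "sets N = sigma_sets D \<G>"
      using \<G>_Pow by (simp_all add: N_def)
    have \<G>_N: "\<phi> (inv\<^bsub>G\<^esub> g) ` ?A n \<in> sets N" if "g \<in> carrier G" "n < 4" for g n
      using that by (auto simp: sets_N \<G>_def)
    have pred_A: "Measurable.pred N (\<lambda>x. T i x \<in> ?A n)" if "n < 4" for i n
    proof -
      have "{x \<in> D. T i x \<in> ?A n} = \<phi> (inv\<^bsub>G\<^esub> e i) ` ?A n"
        using image_inv[of "e i" "\<lambda>x. x \<in> ?A n"] e by (simp add: T_def)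
      then show ?thesis using \<G>_N[OF e that] by (simp add: pred_def space_N)
    qed
    have pred_C: "Measurable.pred N (\<lambda>x. T i x \<in> C)" for i
    proof -
      \<comment> \<open>Within \<open>D\<close>, \<open>C\<close> is the union of pieces 0 and 1;
        likewise \<open>B\<close> is that of pieces 0 and 2.\<close>
      have "Measurable.pred N (\<lambda>x. T i x \<in> ?A 0 \<or> T i x \<in> ?A 1)"
        by (intro pred_intros_logic pred_A) simp_all
      then show ?thesis
        by (rule measurable_cong[THEN iffD1, rotated]) (use D_T in \<open>auto simp: space_N\<close>)
    qed
    have pred_B: "Measurable.pred N (\<lambda>x. T i x \<in> B)" for i
    proof -
      have "Measurable.pred N (\<lambda>x. T i x \<in> ?A 0 \<or> T i x \<in> ?A 2)"
        by (intro pred_intros_logic pred_A) simp_all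
      then show ?thesis
        by (rule measurable_cong[THEN iffD1, rotated]) (use D_T in \<open>auto simp: space_N\<close>)
    qed
    \<comment> \<open>Measurability of the inclusion puts all Borel traces on \<open>D\<close> into
      \<open>N\<close>. It suffices to treat open sets, which are countable unions of the basic sets
      recovered by \<open>coding\<close>.\<close>
    have "(\<lambda>x. x) \<in> measurable N (borel_of X)"
      unfolding borel_of_def
    proof (rule measurable_measure_of)
      fix V assume "V \<in> {V. openin X V}"
      then have V: "openin X V" by simp
      have "V \<inter> D = (\<Union>n\<in>{n. U n \<subseteq> V}. U n \<inter> D)"
        using base_at[OF V] by blast
      also have "\<dots> \<in> sets N"
        using coding[OF space_N pred_C pred_B] by (intro sets.countable_UN') auto
      finally show "(\<lambda>x. x) -` V \<inter> space N \<in> sets N" by (simp add: space_N)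
    qed (use openin_subset DX in \<open>auto simp: space_N\<close>)
    then have "S \<inter> D \<in> sets N" if "S \<in> sets (borel_of X)" for S
      using measurable_sets[of "\<lambda>x. x" N "borel_of X" S] that by (simp add: space_N)
    then have "sets ?M \<subseteq> sets N" using sets_M by (metis inf.absorb1 subsetI)
    moreover have "sigma_sets (space ?M) \<G> \<subseteq> sets ?M"
      using \<G>_sets by (rule sets.sigma_sets_subset)
    ultimately have "sigma_sets (space ?M) \<G> = sets ?M"
      by (simp add: sets_N space_M)
    moreover have "disjoint_family_on ?A {..<4}"
    proof -
      have "m = n" if "m < 4" "n < 4" "m < 2 \<longleftrightarrow> n < 2" "even m \<longleftrightarrow> even n" for m n :: nat
        using that by presburger
      then show ?thesis unfolding disjoint_family_on_def by blast
    qed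
    moreover have "(\<Union>n<4. ?A n) = D"
    proof -
      have "x \<in> (\<Union>n<4. ?A n)" if "x \<in> D" for x
      proof
        let ?n = "(if x \<in> C then 0 else 2) + (if x \<in> B then 0 else 1) :: nat"
        show "?n \<in> {..<4}" "x \<in> ?A ?n" using that by auto
      qed
      then show ?thesis by blast
    qed
    ultimately show ?thesis
      unfolding is_generator_def \<G>_def using A_sets by (simp add: space_M)
  qed
  ultimately show ?thesis using D by blast
qed

end
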